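(* Let $(S,+)$ be a commutative cancellative semigroup with no identity element such that its difference group $S-S$ carries a multiplication making it an integral domain, and let $\kappa=|S|$ be infinite. (1) If there is a family of $\delta$ almost disjoint subsets of $\kappa$, then every $C_p$-set in $S$ contains a family of $\delta$ almost disjoint subsets each of which is a $C_p$-set. (2) Every $C_p$-set in $S$ can be split into $\kappa$ pairwise disjoint subsets each of which is a $C_p$-set.
   Context: $S-S=\{a-b:a,b\in S\}$ is the difference group of $S$. $\mathbb{P}$: polynomial functions $S-S\to S-S$ in one variable with coefficients in $S-S$ and zero constant term. $\mathcal{P}_f(X)$: nonempty finite subsets of $X$; ${}^{\mathbb{N}}S$: sequences in $S$; $\mathbb{N}=\{1,2,\dots\}$. $S_{R,L}(a,H)=\{a+f(\sum_{t\in H}g(t)): f\in R,g\in L\}$. $A\subseteq S$ is a $J_p$-set if for every $R\in\mathcal{P}_f(\mathbb{P})$, $L\in\mathcal{P}_f({}^{\mathbb{N}}S)$ there exist $a\in S$, $H\in\mathcal{P}_f(\mathbb{N})$ with $S_{R,L}(a,H)\subseteq A$. $\beta S$ is the Stone–Čech compactification of discrete $S$ (ultrafilters), with $A\in p+q$ iff $\{x: -x+A\in q\}\in p$ where $-x+A=\{s:x+s\in A\}$. $\mathcal{J}_p=\{p\in\beta S:$ every member of $p$ is a $J_p$-set$\}$. $A$ is a $C_p$-set if there is an idempotent $p\in\mathcal{J}_p$ ($p+p=p$) with $A\in p$. For an infinite set $X$, a family of almost disjoint subsets of $X$ consists of subsets of $X$ of cardinality $|X|$, any two distinct of which meet in fewer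 than $|X|$ points. *)

theory Defs
  imports Main "HOL-Library.Equipollence" "HOL-Computational_Algebra.Polynomial"
begin

text \<open>Ambient type: an integral domain playing the role of the difference group S - S.\<close>

definition diff_set :: "'a::ab_group_add set \<Rightarrow> 'a set" where
  "diff_set S = {a - b | a b. a \<in> S \<and> b \<in> S}"

definition PolyFuns :: "('a::comm_ring_1 \<Rightarrow> 'a) set" where
  "PolyFuns = {f. \<exists>p. coeff p 0 = 0 \<and> f = poly p}"

definition S_RL :: "('a::comm_ring_1 \<Rightarrow> 'a) set \<Rightarrow> (nat \<Rightarrow> 'a) set \<Rightarrow> 'a \<Rightarrow> nat set \<Rightarrow> 'a set" where
  "S_RL R L a H = {a + f (\<Sum>t\<in>H. g t) | f g. f \<in> R \<and> g \<in> L}"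

text \<open>Sequences are indexed by the positive naturals \<open>{1,2,...}\<close>.\<close>
definition JpSet :: "'a::comm_ring_1 set \<Rightarrow> 'a set \<Rightarrow> bool" where
  "JpSet S A \<longleftrightarrow> A \<subseteq> S \<and>
     (\<forall>R L. finite R \<and> R \<noteq> {} \<and> R \<subseteq> PolyFuns \<and>
            finite L \<and> L \<noteq> {} \<and> (\<forall>g\<in>L. \<forall>t\<ge>1. g t \<in> S)
        \<longrightarrow> (\<exists>a\<in>S. \<exists>H. finite H \<and> H \<noteq> {} \<and> H \<subseteq> {1..} \<and> S_RL R L a H \<subseteq> A))"

text \<open>Ultrafilters on the discrete set S (points of beta S), as families of subsets of S.\<close>
definition ultrafilter_on :: "'a set \<Rightarrow> 'a set set \<Rightarrow> bool" where
  "ultrafilter_on S p \<longleftrightarrow> p \<subseteq> Pow S \<and> S \<in> p \<and> {} \<notin> p \<and>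
     (\<forall>A\<in>p. \<forall>B\<in>p. A \<inter> B \<in> p) \<and>
     (\<forall>A\<in>p. \<forall>B. A \<subseteq> B \<and> B \<subseteq> S \<longrightarrow> B \<in> p) \<and>
     (\<forall>A. A \<subseteq> S \<longrightarrow> A \<in> p \<or> S - A \<in> p)"

definition uf_plus :: "'a::plus set \<Rightarrow> 'a set set \<Rightarrow> 'a set set \<Rightarrow> 'a set set" where
  "uf_plus S p q = {A. A \<subseteq> S \<and> {x \<in> S. {s \<in> S. x + s \<in> A} \<in> q} \<in> p}"

definition JpUF :: "'a::comm_ring_1 set \<Rightarrow> 'a set set set" where
  "JpUF S = {p. ultrafilter_on S p \<and> (\<forall>A\<in>p. JpSet S A)}"

definition CpSet :: "'a::comm_ring_1 set \<Rightarrow> 'a set \<Rightarrow> bool" where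
  "CpSet S A \<longleftrightarrow> (\<exists>p \<in> JpUF S. uf_plus S p p = p \<and> A \<in> p)"

definition ad_family :: "'a set \<Rightarrow> 'a set set \<Rightarrow> bool" where
  "ad_family X F \<longleftrightarrow> (\<forall>B\<in>F. B \<subseteq> X \<and> B \<approx> X) \<and>
     (\<forall>B\<in>F. \<forall>C\<in>F. B \<noteq> C \<longrightarrow> B \<inter> C \<prec> X)"

end

theory Submission
  imports Defs "HOL-Algebra.Free_Abelian_Groups"
begin

text \<open>
  Let \<open>p\<close> be an idempotent witnessing that \<open>A\<close> is a \<open>C\<^sub>p\<close>-set, and let \<open>A' = {x \<in> A. -x + A \<in> p}\<close>, so that
  \<open>-x + A' \<in> p\<close> for all \<open>x \<in> A'\<close>. Members of \<open>p\<close> have the cardinality of \<open>S\<close>, hence a transfinite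
  recursion yields points \<open>y (b, E)\<close>, indexed by \<open>b \<in> S\<close> and finite \<open>E \<subseteq> S\<close>, which lie in
  \<open>-x + A'\<close> for all \<open>x \<in> E \<inter> A'\<close> and whose translates \<open>E + y (b, E)\<close> are pairwise disjoint.
  For \<open>B \<subseteq> S\<close> of full cardinality choose an injection \<open>c\<close> from the finite subsets of \<open>S\<close> into \<open>B\<close>
  and let \<open>Z B\<close> be the union of the sets \<open>E + y (c E, E)\<close>. An ultrafilter \<open>q\<close> containing all sets
  \<open>{y (c E, E) | E. E\<^sub>0 \<subseteq> E}\<close> contains every \<open>-x + Z B\<close>, so \<open>p + q\<close> lies in the closed subsemigroup of all
  \<open>r \<in> \<J>\<^sub>p\<close> containing \<open>A'\<close>, \<open>Z B\<close>, every \<open>-x + A'\<close> with \<open>x \<in> A'\<close> and every \<open>-x + Z B\<close>. An idempotent of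
  this semigroup shows that \<open>A' \<inter> Z B\<close> is a \<open>C\<^sub>p\<close>-set, and \<open>Z B \<inter> Z C\<close> is covered by finite sets
  indexed by \<open>B \<inter> C\<close>.
\<close>

section \<open>Ultrafilters and idempotents\<close>

text \<open>This is \<open>-x + A\<close> cut down to \<open>S\<close>, the set used in the addition
  of ultrafilters.\<close>

definition shift :: "'a::plus set \<Rightarrow> 'a \<Rightarrow> 'a set \<Rightarrow> 'a set" where
  "shift S x A = {s \<in> S. x + s \<in> A}"

text \<open>
  All closed sets of ultrafilters have this form, and a larger family \<open>C\<close> gives a smaller set: minimal
  closed subsemigroups are obtained from maximal families.
\<close>
definition uf_closure :: "'a set \<Rightarrow> 'a set set \<Rightarrow> 'a set set set" where
  "uf_closure S C = {p. ultrafilter_on S p \<and> C \<subseteq> p}"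

lemma shift_subset: "shift S x A \<subseteq> S"
  by (auto simp: shift_def)

lemma shift_shift:
  fixes S :: "'a::semigroup_add set"
  assumes "\<And>x y. x \<in> S \<Longrightarrow> y \<in> S \<Longrightarrow> x + y \<in> S" "y \<in> S"
  shows "shift S y (shift S x A) = shift S (x + y) A"
  using assms by (auto simp: shift_def add.assoc)

lemma mem_uf_plus: "A \<in> uf_plus S p q \<longleftrightarrow> A \<subseteq> S \<and> {x \<in> S. shift S x A \<in> q} \<in> p"
  by (simp add: uf_plus_def shift_def)

lemma ultrafilter_onD:
  assumes "ultrafilter_on S p"
  shows "A \<in> p \<Longrightarrow> A \<subseteq> S" "S \<in> p" "{} \<notin> p"
    "A \<in> p \<Longrightarrow> B \<in> p \<Longrightarrow> A \<inter> B \<in> p"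
    "A \<in> p \<Longrightarrow> A \<subseteq> B \<Longrightarrow> B \<subseteq> S \<Longrightarrow> B \<in> p"
    "A \<subseteq> S \<Longrightarrow> S - A \<in> p \<longleftrightarrow> A \<notin> p"
proof -
  have u: "p \<subseteq> Pow S" "S \<in> p" "{} \<notin> p" "\<And>A B. A \<in> p \<Longrightarrow> B \<in> p \<Longrightarrow> A \<inter> B \<in> p"
    "\<And>A B. A \<in> p \<Longrightarrow> A \<subseteq> B \<Longrightarrow> B \<subseteq> S \<Longrightarrow> B \<in> p"
    "\<And>A. A \<subseteq> S \<Longrightarrow> A \<in> p \<or> S - A \<in> p"
    using assms by (simp_all add: ultrafilter_on_def)
  show "A \<in> p \<Longrightarrow> A \<subseteq> S" using u(1) by blast
  show "S \<in> p" "{} \<notin> p" "A \<in> p \<Longrightarrow> B \<in> p \<Longrightarrow> A \<inter> B \<in> p"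
    "A \<in> p \<Longrightarrow> A \<subseteq> B \<Longrightarrow> B \<subseteq> S \<Longrightarrow> B \<in> p"
    using u by simp_all
  show "A \<subseteq> S \<Longrightarrow> S - A \<in> p \<longleftrightarrow> A \<notin> p"
    using u(3) u(4)[of A "S - A"] u(6)[of A] by auto
qed

lemma ultrafilter_on_Inter:
  assumes "ultrafilter_on S p" "finite X" "X \<subseteq> p"
  shows "S \<inter> \<Inter>X \<in> p"
  using assms(2,3)
proof induction
  case empty
  then show ?case using ultrafilter_onD(2)[OF assms(1)] by simp
next
  case (insert A X)
  then have "A \<inter> (S \<inter> \<Inter>X) \<in> p"
    using ultrafilter_onD(4)[OF assms(1)] by simp
  then show ?case by (simp add: Int_left_commute)
qed

lemma ultrafilter_on_eqI:
  assumes "ultrafilter_on S p" "ultrafilter_on S q" "p \<subseteq> q"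
  shows "p = q"
proof
  show "q \<subseteq> p"
    using assms ultrafilter_onD(1,6) by (metis subsetD subsetI)
qed fact

text \<open>Compactness of \<beta>S. By Zorn, a family with the finite intersection property extends
  to a maximal one, and maximality turns that one into an ultrafilter. Intersecting with
  \<open>S\<close> makes the case \<open>X = {}\<close> assert that \<open>S\<close> is
  nonempty.\<close>

lemma uf_closure_nonempty_iff:
  assumes "C \<subseteq> Pow S"
  shows "uf_closure S C \<noteq> {} \<longleftrightarrow> (\<forall>X. finite X \<and> X \<subseteq> C \<longrightarrow> S \<inter> \<Inter>X \<noteq> {})"
proof
  assume "uf_closure S C \<noteq> {}"
  then obtain p where p: "ultrafilter_on S p" "C \<subseteq> p" by (auto simp: uf_closure_def)
  have "S \<inter> \<Inter>X \<noteq> {}" if "finite X" "X \<subseteq> C" for X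
    using ultrafilter_on_Inter[OF p(1) that(1) subset_trans[OF that(2) p(2)]]
      ultrafilter_onD(3)[OF p(1)] by metis
  then show "\<forall>X. finite X \<and> X \<subseteq> C \<longrightarrow> S \<inter> \<Inter>X \<noteq> {}" by blast
next
  assume fip: "\<forall>X. finite X \<and> X \<subseteq> C \<longrightarrow> S \<inter> \<Inter>X \<noteq> {}"
  define \<A> where "\<A> = {D. C \<subseteq> D \<and> D \<subseteq> Pow S \<and> (\<forall>X. finite X \<and> X \<subseteq> D \<longrightarrow> S \<inter> \<Inter>X \<noteq> {})}"
  have "\<exists>M\<in>\<A>. \<forall>X\<in>\<A>. M \<subseteq> X \<longrightarrow> X = M"
  proof (rule subset_Zorn_nonempty)
    show "\<A> \<noteq> {}" using fip assms unfolding \<A>_def by blast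
    fix \<C> assume ne: "\<C> \<noteq> {}" and ch: "subset.chain \<A> \<C>"
    then have sub: "\<C> \<subseteq> \<A>" by (simp add: subset.chain_def)
    have "S \<inter> \<Inter>X \<noteq> {}" if X: "finite X" "X \<subseteq> \<Union>\<C>" for X
    proof -
      obtain C where C: "C \<in> \<C>" "X \<subseteq> C" using finite_subset_Union_chain[OF X ne ch] by blast
      then have "C \<in> \<A>" using sub by blast
      then show ?thesis using X(1) C(2) by (simp add: \<A>_def)
    qed
    moreover have "C \<subseteq> D" "D \<subseteq> Pow S" if "D \<in> \<C>" for D
      using that sub by (auto simp: \<A>_def)
    then have "C \<subseteq> \<Union>\<C>" "\<Union>\<C> \<subseteq> Pow S"
      using ne by blast+
    ultimately show "\<Union>\<C> \<in> \<A>" by (simp add: \<A>_def)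
  qed
  then obtain p where p: "p \<in> \<A>" and max: "\<And>X. X \<in> \<A> \<Longrightarrow> p \<subseteq> X \<Longrightarrow> X = p" by blast
  have pS: "p \<subseteq> Pow S" and pC: "C \<subseteq> p"
    and pf: "\<And>X. finite X \<Longrightarrow> X \<subseteq> p \<Longrightarrow> S \<inter> \<Inter>X \<noteq> {}"
    using p by (simp_all add: \<A>_def)
  \<comment> \<open>A set that meets all finite intersections from \<open>p\<close> can be added
    without losing the finite intersection property, so by maximality it is already there. The
    closure properties of \<open>p\<close> are all derived from this.\<close>
  have crit: "A \<in> p" if A: "A \<subseteq> S" "\<And>X. finite X \<Longrightarrow> X \<subseteq> p \<Longrightarrow> S \<inter> \<Inter>X \<inter> A \<noteq> {}" for A
  proof -
    have "S \<inter> \<Inter>X \<noteq> {}" if "finite X" "X \<subseteq> insert A p" for X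
    proof -
      have "finite (X - {A})" "X - {A} \<subseteq> p" using that by auto
      then have "S \<inter> \<Inter>(X - {A}) \<inter> A \<noteq> {}" by (rule A(2))
      moreover have "S \<inter> \<Inter>(X - {A}) \<inter> A \<subseteq> S \<inter> \<Inter>X" by blast
      ultimately show ?thesis by auto
    qed
    moreover have "insert A p \<subseteq> Pow S" "C \<subseteq> insert A p" using A(1) pS pC by auto
    ultimately have "insert A p \<in> \<A>" by (simp add: \<A>_def)
    then have "insert A p = p" using max by blast
    then show ?thesis by blast
  qed
  have inter: "S \<inter> \<Inter>X \<inter> \<Inter>Y \<noteq> {}" if "finite X" "X \<subseteq> p" "finite Y" "Y \<subseteq> p" for X Y
    using pf[of "X \<union> Y"] that by (simp add: Int_assoc Inter_Un_distrib)
  have "ultrafilter_on S p"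
    unfolding ultrafilter_on_def
  proof (intro conjI ballI allI impI)
    show "p \<subseteq> Pow S" by fact
    show "S \<in> p"
    proof (rule crit)
      show "S \<inter> \<Inter>X \<inter> S \<noteq> {}" if "finite X" "X \<subseteq> p" for X
        using pf[OF that] by (simp add: Int_commute Int_left_commute)
    qed simp
    show "{} \<notin> p"
    proof
      assume "{} \<in> p"
      then show False using pf[of "{{}}"] by simp
    qed
  next
    fix A B assume AB: "A \<in> p" "B \<in> p"
    show "A \<inter> B \<in> p"
    proof (rule crit)
      show "A \<inter> B \<subseteq> S" using AB pS by blast
      show "S \<inter> \<Inter>X \<inter> (A \<inter> B) \<noteq> {}" if "finite X" "X \<subseteq> p" for X
        using inter[OF that, of "{A, B}"] AB by simp
    qed
  next
    fix A B assume A: "A \<in> p" and AB: "A \<subseteq> B \<and> B \<subseteq> S"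
    show "B \<in> p"
    proof (rule crit)
      show "S \<inter> \<Inter>X \<inter> B \<noteq> {}" if "finite X" "X \<subseteq> p" for X
        using inter[OF that, of "{A}"] A AB by auto
    qed (use AB in simp)
  next
    fix A assume A: "A \<subseteq> S"
    show "A \<in> p \<or> S - A \<in> p"
    proof (rule ccontr)
      assume n: "\<not> ?thesis"
      \<comment> \<open>If \<open>p\<close> decides neither way, one finite intersection misses
        \<open>A\<close> and another misses \<open>S - A\<close>; their common part is then
        empty.\<close>
      obtain X where X: "finite X" "X \<subseteq> p" "S \<inter> \<Inter>X \<inter> A = {}"
        using crit[OF A] n by meson
      obtain Y where Y: "finite Y" "Y \<subseteq> p" "S \<inter> \<Inter>Y \<inter> (S - A) = {}"
        using crit[of "S - A"] n by (meson Diff_subset)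
      have "S \<inter> \<Inter>X \<inter> \<Inter>Y \<subseteq> (S \<inter> \<Inter>X \<inter> A) \<union> (S \<inter> \<Inter>Y \<inter> (S - A))" by auto
      then show False using inter[OF X(1,2) Y(1,2)] X(3) Y(3) by simp
    qed
  qed
  then show "uf_closure S C \<noteq> {}" using pC unfolding uf_closure_def by blast
qed

section \<open>The semigroup of ultrafilters and its idempotents\<close>

context
  fixes S :: "'a::semigroup_add set"
  assumes add_closed: "\<And>x y. x \<in> S \<Longrightarrow> y \<in> S \<Longrightarrow> x + y \<in> S"
begin

text \<open>For \<open>x\<close> in \<open>S\<close>, shifting respects inclusion, intersection and
  complement in \<open>S\<close>. Each axiom therefore passes first through \<open>q\<close> and
  then through \<open>p\<close>.\<close>

lemma ultrafilter_on_plus: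
  assumes p: "ultrafilter_on S p" and q: "ultrafilter_on S q"
  shows "ultrafilter_on S (uf_plus S p q)"
proof -
  note P = ultrafilter_onD[OF p] and Q = ultrafilter_onD[OF q]
  have sh: "shift S x (A \<inter> B) = shift S x A \<inter> shift S x B"
    "x \<in> S \<Longrightarrow> shift S x (S - A) = S - shift S x A" "x \<in> S \<Longrightarrow> shift S x S = S"
    "shift S x {} = {}" "A \<subseteq> B \<Longrightarrow> shift S x A \<subseteq> shift S x B" for x A B
    using add_closed by (auto simp: shift_def)
  show ?thesis
    unfolding ultrafilter_on_def
  proof (intro conjI ballI allI impI)
    show "uf_plus S p q \<subseteq> Pow S" by (auto simp: mem_uf_plus)
    have "{x \<in> S. shift S x S \<in> q} = S" using sh(3) Q(2) by auto
    then show "S \<in> uf_plus S p q" using P(2) by (simp add: mem_uf_plus)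
    show "{} \<notin> uf_plus S p q" using P(3) Q(3) by (simp add: mem_uf_plus sh(4))
  next
    fix A B assume A: "A \<in> uf_plus S p q" and B: "B \<in> uf_plus S p q"
    then have "{x \<in> S. shift S x A \<in> q} \<inter> {x \<in> S. shift S x B \<in> q} \<in> p"
      using P(4) by (simp add: mem_uf_plus)
    then have "{x \<in> S. shift S x (A \<inter> B) \<in> q} \<in> p"
      by (rule P(5)) (use Q(4) in \<open>auto simp: sh(1)\<close>)
    then show "A \<inter> B \<in> uf_plus S p q"
      using A by (auto simp: mem_uf_plus)
  next
    fix A B assume A: "A \<in> uf_plus S p q" and B: "A \<subseteq> B \<and> B \<subseteq> S"
    then have "shift S x B \<in> q" if "shift S x A \<in> q" for x
      using Q(5)[OF that sh(5) shift_subset] by simp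
    then have sub: "{x \<in> S. shift S x A \<in> q} \<subseteq> {x \<in> S. shift S x B \<in> q}"
      by blast
    have "{x \<in> S. shift S x A \<in> q} \<in> p" using A by (simp add: mem_uf_plus)
    then have "{x \<in> S. shift S x B \<in> q} \<in> p" by (rule P(5)[OF _ sub]) auto
    then show "B \<in> uf_plus S p q"
      using B by (simp add: mem_uf_plus)
  next
    fix A assume A: "A \<subseteq> S"
    have "{x \<in> S. shift S x (S - A) \<in> q} = S - {x \<in> S. shift S x A \<in> q}"
      using sh(2) Q(6)[OF shift_subset] by auto
    then show "A \<in> uf_plus S p q \<or> S - A \<in> uf_plus S p q"
      using A P(6)[of "{x \<in> S. shift S x A \<in> q}"] by (auto simp: mem_uf_plus)
  qed
qed

lemma shift_mem_uf_plus:
  assumes "ultrafilter_on S q" "y \<in> S"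
  shows "shift S y A \<in> uf_plus S p q \<longleftrightarrow> {x \<in> S. shift S (y + x) A \<in> q} \<in> p"
proof -
  have "{x \<in> S. shift S x (shift S y A) \<in> q} = {x \<in> S. shift S (y + x) A \<in> q}"
    using shift_shift[OF add_closed] by auto
  then show ?thesis by (simp add: mem_uf_plus shift_subset)
qed

text \<open>Both sides say that for \<open>p\<close>-many \<open>x\<close>, \<open>q\<close>-many
  \<open>y\<close> and \<open>r\<close>-many \<open>z\<close> the sum \<open>x + y + z\<close> lies
  in \<open>A\<close>.\<close>

lemma uf_plus_assoc:
  assumes "ultrafilter_on S p" "ultrafilter_on S q" "ultrafilter_on S r"
  shows "uf_plus S (uf_plus S p q) r = uf_plus S p (uf_plus S q r)"
proof -
  have "shift S x {y \<in> S. shift S y A \<in> r} = {y \<in> S. shift S (x + y) A \<in> r}"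
    if "x \<in> S" for x A
    using that add_closed by (auto simp: shift_def)
  then have "{x \<in> S. shift S x {y \<in> S. shift S y A \<in> r} \<in> q}
      = {x \<in> S. shift S x A \<in> uf_plus S q r}" for A
    using shift_mem_uf_plus[OF assms(3)] by auto
  then show ?thesis by (auto simp: mem_uf_plus)
qed

text \<open>Right translation by \<open>p\<close> is continuous, so it maps a closed, hence compact,
  set onto a closed set. The assumption \<open>mem\<close> says that \<open>r\<close> lies in the
  closure of the image.\<close>

lemma right_translate_closed:
  assumes C: "C \<subseteq> Pow S" and p: "ultrafilter_on S p" and r: "ultrafilter_on S r"
    and mem: "\<And>A. A \<subseteq> S \<Longrightarrow> (\<And>s. s \<in> uf_closure S C \<Longrightarrow> A \<in> uf_plus S s p) \<Longrightarrow> A \<in> r"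
  shows "\<exists>s\<in>uf_closure S C. uf_plus S s p = r"
proof -
  \<comment> \<open>\<open>A\<close> belongs to \<open>uf_plus S s p\<close> exactly when
    \<open>D A\<close> belongs to \<open>s\<close>, for \<open>A \<subseteq> S\<close>. The wanted
    \<open>s\<close> must contain \<open>C\<close> and all \<open>D A\<close> with \<open>A\<close>
    in \<open>r\<close>, so compactness reduces the claim to finite intersections.\<close>
  define D where "D A = {x \<in> S. shift S x A \<in> p}" for A
  have "S \<inter> \<Inter>X \<noteq> {}" if X: "finite X" "X \<subseteq> C \<union> D ` r" for X
  proof
    assume empty: "S \<inter> \<Inter>X = {}"
    obtain Y where Y: "Y \<subseteq> r" "finite Y" "X \<inter> D ` r = D ` Y"
      using finite_subset_image[of "X \<inter> D ` r" D r] X(1) by (metis finite_Int inf_le2)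
    define A where "A = S \<inter> \<Inter>Y"
    have A: "A \<in> r" unfolding A_def by (rule ultrafilter_on_Inter[OF r Y(2,1)])
    have AS: "A \<subseteq> S" by (simp add: A_def)
    have DA: "D A \<subseteq> D B" if "B \<in> Y" for B
    proof -
      have "shift S x A \<subseteq> shift S x B" for x using that by (auto simp: A_def shift_def)
      then show ?thesis
        using ultrafilter_onD(5)[OF p _ _ shift_subset] by (auto simp: D_def)
    qed
    \<comment> \<open>An \<open>s\<close> containing \<open>D A\<close> would contain every member
      of \<open>X\<close>, whose intersection within \<open>S\<close> is empty. Hence
      \<open>S - A\<close> lies in every translate, and \<open>mem\<close> puts it into
      \<open>r\<close>, against \<open>A \<in> r\<close>.\<close>
    have "S - A \<in> uf_plus S s p" if s: "s \<in> uf_closure S C" for s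
    proof -
      have us: "ultrafilter_on S s" and Cs: "C \<subseteq> s" using s by (auto simp: uf_closure_def)
      have "D A \<notin> s"
      proof
        assume DAs: "D A \<in> s"
        have "D B \<in> s" if "B \<in> Y" for B
          using ultrafilter_onD(5)[OF us DAs DA[OF that]] by (auto simp: D_def)
        then have "D ` Y \<subseteq> s" by blast
        moreover have "X \<subseteq> C \<union> D ` Y" using X(2) Y(3) by auto
        ultimately have "X \<subseteq> s" using Cs by (meson Un_least subset_trans)
        then show False
          using ultrafilter_on_Inter[OF us X(1)] empty ultrafilter_onD(3)[OF us] by simp
      qed
      then have "A \<notin> uf_plus S s p" by (simp add: mem_uf_plus D_def)
      then show ?thesis
        using ultrafilter_onD(6)[OF ultrafilter_on_plus[OF us p] AS] by simp
    qed
    then have "S - A \<in> r" by (intro mem) auto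
    then show False using A ultrafilter_onD(6)[OF r AS] by simp
  qed
  moreover have "C \<union> D ` r \<subseteq> Pow S" using C by (auto simp: D_def)
  ultimately obtain s where s: "s \<in> uf_closure S (C \<union> D ` r)"
    using uf_closure_nonempty_iff[of "C \<union> D ` r" S] by blast
  then have us: "ultrafilter_on S s" and sC: "s \<in> uf_closure S C" and sD: "D ` r \<subseteq> s"
    by (auto simp: uf_closure_def)
  have "A \<in> uf_plus S s p" if "A \<in> r" for A
    using imageI[OF that, of D] sD ultrafilter_onD(1)[OF r that] by (auto simp: mem_uf_plus D_def)
  then have "r \<subseteq> uf_plus S s p" by blast
  then show ?thesis
    using ultrafilter_on_eqI[OF r ultrafilter_on_plus[OF us p]] sC by blast
qed

text \<open>The Ellis-Numakura argument. Take a minimal closed subsemigroup \<open>K\<close> and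
  \<open>p\<close> in it. Minimality gives first \<open>K + p = K\<close>, then that all
  \<open>s\<close> in \<open>K\<close> solve \<open>s + p = p\<close>; the choice
  \<open>s = p\<close> shows that \<open>p\<close> is idempotent.\<close>

lemma idempotent_in_closed_semigroup:
  assumes B: "B \<subseteq> Pow S" "uf_closure S B \<noteq> {}"
    and plus: "\<And>p q. p \<in> uf_closure S B \<Longrightarrow> q \<in> uf_closure S B \<Longrightarrow> uf_plus S p q \<in> uf_closure S B"
  shows "\<exists>p\<in>uf_closure S B. uf_plus S p p = p"
proof -
  define \<A> where "\<A> = {C. B \<subseteq> C \<and> C \<subseteq> Pow S \<and> uf_closure S C \<noteq> {} \<and>
    (\<forall>p\<in>uf_closure S C. \<forall>q\<in>uf_closure S C. uf_plus S p q \<in> uf_closure S C)}"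
  have "\<exists>M\<in>\<A>. \<forall>X\<in>\<A>. M \<subseteq> X \<longrightarrow> X = M"
  proof (rule subset_Zorn_nonempty)
    show "\<A> \<noteq> {}" using assms unfolding \<A>_def by blast
    fix \<C> assume ne: "\<C> \<noteq> {}" and ch: "subset.chain \<A> \<C>"
    then have sub: "\<C> \<subseteq> \<A>" by (simp add: subset.chain_def)
    have PS: "\<Union>\<C> \<subseteq> Pow S" using sub unfolding \<A>_def by blast
    \<comment> \<open>The intersection of a chain of nonempty closed sets is nonempty by
      compactness: a finite \<open>X\<close> already lies in one member of the chain.\<close>
    have "S \<inter> \<Inter>X \<noteq> {}" if X: "finite X" "X \<subseteq> \<Union>\<C>" for X
    proof -
      obtain C where C: "C \<in> \<C>" "X \<subseteq> C" using finite_subset_Union_chain[OF X ne ch] by blast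
      then have "C \<subseteq> Pow S" "uf_closure S C \<noteq> {}" using sub unfolding \<A>_def by blast+
      then show ?thesis using C(2) X(1) by (simp add: uf_closure_nonempty_iff)
    qed
    then have "uf_closure S (\<Union>\<C>) \<noteq> {}" using uf_closure_nonempty_iff[OF PS] by blast
    moreover have "uf_closure S (\<Union>\<C>) = (\<Inter>C\<in>\<C>. uf_closure S C)"
      using ne by (auto simp: uf_closure_def)
    moreover have "B \<subseteq> C" if "C \<in> \<C>" for C
      using that sub by (auto simp: \<A>_def)
    then have "B \<subseteq> \<Union>\<C>" using ne by blast
    moreover have "uf_plus S p q \<in> uf_closure S C"
      if "C \<in> \<C>" "p \<in> uf_closure S C" "q \<in> uf_closure S C" for C p q
      using that sub by (auto simp: \<A>_def)
    ultimately show "\<Union>\<C> \<in> \<A>" using PS by (simp add: \<A>_def)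
  qed
  then obtain C where C: "C \<in> \<A>" and max: "\<And>X. X \<in> \<A> \<Longrightarrow> C \<subseteq> X \<Longrightarrow> X = C" by blast
  let ?K = "uf_closure S C"
  have BC: "B \<subseteq> C" and CS: "C \<subseteq> Pow S"
    and Kplus: "\<And>p q. p \<in> ?K \<Longrightarrow> q \<in> ?K \<Longrightarrow> uf_plus S p q \<in> ?K"
    using C unfolding \<A>_def by auto
  have Ku: "\<And>p. p \<in> ?K \<Longrightarrow> ultrafilter_on S p" by (simp add: uf_closure_def)
  obtain p where p: "p \<in> ?K" using C unfolding \<A>_def by blast
  \<comment> \<open>\<open>C1\<close> defines the closure of \<open>K + p\<close>, which is
    \<open>K + p\<close> itself because right translates of closed sets are closed.\<close>
  define C1 where "C1 = {A. A \<subseteq> S \<and> (\<forall>s\<in>?K. A \<in> uf_plus S s p)}"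
  have K1: "uf_closure S C1 = (\<lambda>s. uf_plus S s p) ` ?K" (is "_ = ?I")
  proof
    show "uf_closure S C1 \<subseteq> ?I"
    proof
      fix t assume "t \<in> uf_closure S C1"
      then have t: "ultrafilter_on S t" "C1 \<subseteq> t" by (auto simp: uf_closure_def)
      have "\<exists>s\<in>?K. uf_plus S s p = t"
        by (rule right_translate_closed[OF CS Ku[OF p] t(1)]) (use t(2) in \<open>auto simp: C1_def\<close>)
      then show "t \<in> ?I" by blast
    qed
    have "uf_plus S s p \<in> uf_closure S C1" if "s \<in> ?K" for s
    proof -
      have "C1 \<subseteq> uf_plus S s p" using that by (auto simp: C1_def)
      then show ?thesis
        using ultrafilter_on_plus[OF Ku[OF that] Ku[OF p]] by (simp add: uf_closure_def)
    qed
    then show "?I \<subseteq> uf_closure S C1" by blast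
  qed
  have CK: "A \<in> s" if "A \<in> C" "s \<in> ?K" for A s
    using that by (auto simp: uf_closure_def)
  have "C \<subseteq> C1"
    using CK Kplus[OF _ p] CS by (auto simp: C1_def)
  moreover have "C1 \<in> \<A>"
  proof -
    have "uf_plus S (uf_plus S s p) (uf_plus S t p) \<in> ?I" if st: "s \<in> ?K" "t \<in> ?K" for s t
    proof
      show "uf_plus S (uf_plus S s p) (uf_plus S t p) = uf_plus S (uf_plus S (uf_plus S s p) t) p"
        using st p by (simp add: uf_plus_assoc ultrafilter_on_plus Ku)
      show "uf_plus S (uf_plus S s p) t \<in> ?K" using st p Kplus by blast
    qed
    moreover have "B \<subseteq> C1" using \<open>C \<subseteq> C1\<close> BC by (rule subset_trans[rotated])
    moreover have "C1 \<subseteq> Pow S" by (auto simp: C1_def)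
    moreover have "?I \<noteq> {}" using p by blast
    ultimately show ?thesis
      by (simp add: \<A>_def K1)
  qed
  \<comment> \<open>So \<open>K + p = K\<close>, and \<open>p\<close> itself is of the form
    \<open>s + p\<close>; this \<open>s\<close> keeps the next closed set nonempty.\<close>
  ultimately have "C1 = C" using max by blast
  then have "p \<in> ?I" using K1 p by simp
  then obtain s where s: "s \<in> ?K" "uf_plus S s p = p" by (metis imageE)
  \<comment> \<open>The added sets encode \<open>p \<subseteq> uf_plus S s p\<close>, which for
    ultrafilters amounts to the equation \<open>s + p = p\<close>.\<close>
  define C2 where "C2 = C \<union> (\<lambda>A. {x \<in> S. shift S x A \<in> p}) ` p"
  have K2: "uf_closure S C2 = {s \<in> ?K. uf_plus S s p = p}"
  proof -
    have "t \<in> uf_closure S C2 \<longleftrightarrow> uf_plus S t p = p" if t: "t \<in> ?K" for t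
    proof -
      have "t \<in> uf_closure S C2 \<longleftrightarrow> (\<forall>A\<in>p. {x \<in> S. shift S x A \<in> p} \<in> t)"
        using t by (simp add: C2_def uf_closure_def image_subset_iff)
      also have "\<dots> \<longleftrightarrow> p \<subseteq> uf_plus S t p"
        using ultrafilter_onD(1)[OF Ku[OF p]] unfolding subset_iff mem_uf_plus by meson
      also have "\<dots> \<longleftrightarrow> uf_plus S t p = p"
        using ultrafilter_on_eqI[OF Ku[OF p] ultrafilter_on_plus[OF Ku[OF t] Ku[OF p]]] by auto
      finally show ?thesis .
    qed
    moreover have "uf_closure S C2 \<subseteq> ?K" by (auto simp: C2_def uf_closure_def)
    ultimately show ?thesis by blast
  qed
  have "C2 \<in> \<A>"
  proof -
    have "uf_plus S (uf_plus S t u) p = p"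
      if "t \<in> ?K" "u \<in> ?K" "uf_plus S t p = p" "uf_plus S u p = p" for t u
      using that p by (simp add: uf_plus_assoc Ku)
    moreover have "B \<subseteq> C2" "C2 \<subseteq> Pow S" using BC CS by (auto simp: C2_def)
    moreover have "uf_closure S C2 \<noteq> {}" using s unfolding K2 by blast
    ultimately show ?thesis using Kplus by (simp add: \<A>_def K2)
  qed
  then have "C2 = C" using max by (simp add: C2_def)
  then have "uf_plus S p p = p" using K2 p by blast
  moreover have "p \<in> uf_closure S B" using p BC by (auto simp: uf_closure_def)
  ultimately show ?thesis by blast
qed

end

section \<open>Cardinality\<close>

lemma lesspoll_iff_card_of_ordLess: "A \<prec> B \<longleftrightarrow> |A| <o |B|"
  by (metis card_of_ordLess lesspoll_def lepoll_def lepoll_antisym card_of_ordLeq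
      ordLess_imp_ordLeq eqpoll_sym eqpoll_imp_lepoll)

lemma lepoll_iff_card_of_ordLeq: "A \<lesssim> B \<longleftrightarrow> |A| \<le>o |B|"
  by (simp add: card_of_ordLeq[symmetric] lepoll_def)

lemma not_lepoll_iff_lesspoll: "\<not> A \<lesssim> B \<longleftrightarrow> B \<prec> A"
  by (simp add: lepoll_iff_card_of_ordLeq lesspoll_iff_card_of_ordLess not_ordLeq_iff_ordLess
      card_of_Well_order)

text \<open>This holds even for singular \<open>|S|\<close>, because the pieces are finite: an
  infinite \<open>I\<close> bounds the size of the union by \<open>|I|\<close>, and a finite
  \<open>I\<close> gives a finite union.\<close>

lemma UN_finite_lesspoll:
  assumes S: "infinite S" and I: "I \<prec> S" and T: "\<And>i. i \<in> I \<Longrightarrow> finite (T i)"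
  shows "(\<Union>i\<in>I. T i) \<prec> S"
proof (cases "finite I")
  case True
  then show ?thesis using T S by (simp add: finite_lesspoll_infinite)
next
  case False
  have "|T i| \<le>o |I|" if "i \<in> I" for i
    using T[OF that] False by (simp add: ordLess_imp_ordLeq)
  then have "|\<Union>i\<in>I. T i| \<le>o |I|"
    using False by (intro card_of_UNION_ordLeq_infinite) (auto simp: ordIso_imp_ordLeq)
  then show ?thesis using I by (metis lepoll_iff_card_of_ordLeq lesspoll_trans1)
qed

lemma Times_lesspoll:
  assumes S: "infinite S" and A: "A \<prec> S"
  shows "A \<times> A \<prec> S"
proof (cases "finite A")
  case True
  then show ?thesis using S by (simp add: finite_lesspoll_infinite)
next
  case False
  then have "A \<times> A \<approx> A"
    by (simp add: eqpoll_iff_card_of_ordIso card_of_Times_same_infinite)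
  then show ?thesis using A eq_lesspoll_trans by blast
qed

text \<open>Recursion along the cardinal order of \<open>J\<close>. At \<open>j\<close>, each
  earlier \<open>i\<close> forbids only the finitely many values \<open>x + y i - x'\<close>. Proper
  initial segments are smaller than \<open>J\<close>, so fewer than \<open>|S|\<close> values are
  forbidden and \<open>M j\<close> is not exhausted.\<close>

lemma disjoint_translates_selection:
  fixes E :: "'i \<Rightarrow> 'a::ab_group_add set"
  assumes S: "infinite S" and J: "J \<lesssim> S"
    and M: "\<And>j. j \<in> J \<Longrightarrow> S \<lesssim> M j" and E: "\<And>j. j \<in> J \<Longrightarrow> finite (E j)"
  obtains y where "\<And>j. j \<in> J \<Longrightarrow> y j \<in> M j"
    and "\<And>i j x x'. \<lbrakk>i \<in> J; j \<in> J; x \<in> E i; x' \<in> E j; x + y i = x' + y j\<rbrakk> \<Longrightarrow> i = j"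
proof -
  \<comment> \<open>Outside \<open>J\<close> the condition is void, so the recursion can produce a
    total \<open>y\<close>.\<close>
  define P where "P y j z \<longleftrightarrow> (j \<in> J \<longrightarrow> z \<in> M j \<and>
     (\<forall>i\<in>underS |J| j. \<forall>x\<in>E i. \<forall>x'\<in>E j. x + y i \<noteq> x' + z))" for y :: "'i \<Rightarrow> 'a" and j z
  have "\<exists>y. \<forall>j. P y j (y j)"
  proof (rule dependent_wf_choice)
    show "wf ( |J| - Id)" using card_of_Well_order well_order_on_def by blast
    show "P f j r = P g j r" if "\<And>z. (z, j) \<in> |J| - Id \<Longrightarrow> f z = g z" for f g j r
      using that unfolding P_def underS_def by auto
    show "\<exists>z. P y j z" for y j
    proof (cases "j \<in> J")
      case True
      let ?bad = "\<Union>i\<in>underS |J| j. (\<lambda>(x, x'). x + y i - x') ` (E i \<times> E j)"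
      have sub: "underS |J| j \<subseteq> J"
        by (metis Field_card_of underS_Field subsetI)
      have "underS |J| j \<prec> J"
        using card_of_underS[OF card_of_Card_order, of j J] True
        by (simp add: lesspoll_iff_card_of_ordLess Field_card_of)
      then have "underS |J| j \<prec> S" using J by (rule lesspoll_trans2)
      then have "?bad \<prec> S"
        using sub E True by (intro UN_finite_lesspoll[OF S]) auto
      then have "?bad \<prec> M j" using M[OF True] by (rule lesspoll_trans2)
      then have "\<not> M j \<subseteq> ?bad"
        by (meson not_lepoll_iff_lesspoll subset_imp_lepoll)
      then obtain z where z: "z \<in> M j" "z \<notin> ?bad" by blast
      have "P y j z" unfolding P_def
      proof (intro impI conjI ballI z(1) notI)
        fix i x x' assume "i \<in> underS |J| j" "x \<in> E i" "x' \<in> E j" "x + y i = x' + z"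
        moreover from this have "z = x + y i - x'" by (simp add: algebra_simps)
        ultimately show False using z(2) by auto
      qed
      then show ?thesis ..
    qed (simp add: P_def)
  qed
  then obtain y where y: "\<And>j. P y j (y j)" by blast
  show thesis
  proof
    show "y j \<in> M j" if "j \<in> J" for j using y[of j] that by (simp add: P_def)
    fix i j x x' assume *: "i \<in> J" "j \<in> J" "x \<in> E i" "x' \<in> E j" "x + y i = x' + y j"
    have total: "i \<in> underS |J| j \<or> j \<in> underS |J| i" if "i \<noteq> j"
      using card_of_well_order_on[of J] that *(1,2)
      unfolding well_order_on_def linear_order_on_def total_on_def underS_def by auto
    show "i = j"
    proof (rule ccontr)
      assume "i \<noteq> j"
      then show False
        using total y[of i] y[of j] * unfolding P_def by metis
    qed
  qed
qed

text \<open>Choose \<open>d n\<close> outside all \<open>t - sum d H\<close> with \<open>t\<close>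
  in \<open>T\<close> and \<open>H \<subseteq> {..<n}\<close>; these are too few to exhaust the
  group.\<close>

lemma finite_sums_avoid:
  fixes T :: "'a::ab_group_add set"
  assumes "infinite (UNIV :: 'a set)" "T \<prec> (UNIV :: 'a set)"
  obtains d :: "nat \<Rightarrow> 'a" where "\<And>H. finite H \<Longrightarrow> H \<noteq> {} \<Longrightarrow> sum d H \<notin> T"
proof -
  have "\<exists>d :: nat \<Rightarrow> 'a. \<forall>n. \<forall>H\<in>Pow {..<n}. d n + sum d H \<notin> T"
  proof (rule dependent_wellorder_choice[where P="\<lambda>d n r. \<forall>H\<in>Pow {..<n}. r + sum d H \<notin> T"])
    show "(\<forall>H\<in>Pow {..<n}. r + sum f H \<notin> T) = (\<forall>H\<in>Pow {..<n}. r + sum g H \<notin> T)"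
      if eq: "\<And>m. m < n \<Longrightarrow> f m = g m" for r and f g :: "nat \<Rightarrow> 'a" and n
    proof -
      have "sum f H = sum g H" if "H \<in> Pow {..<n}" for H
        using that eq by (intro sum.cong) auto
      then show ?thesis by simp
    qed
    show "\<exists>r. \<forall>H\<in>Pow {..<n}. r + sum d H \<notin> T" for n and d :: "nat \<Rightarrow> 'a"
    proof -
      let ?bad = "\<Union>t\<in>T. (\<lambda>H. t - sum d H) ` Pow {..<n}"
      have "?bad \<prec> (UNIV :: 'a set)"
        by (rule UN_finite_lesspoll[OF assms]) simp
      then have "?bad \<noteq> UNIV" by (auto simp: lesspoll_def)
      then obtain r where r: "r \<notin> ?bad" by blast
      have "r + sum d H \<notin> T" if "H \<in> Pow {..<n}" for H
      proof
        assume "r + sum d H \<in> T"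
        moreover have "r = (r + sum d H) - sum d H" by simp
        ultimately show False using r that by blast
      qed
      then show ?thesis by blast
    qed
  qed
  then obtain d :: "nat \<Rightarrow> 'a" where d: "\<And>n H. H \<subseteq> {..<n} \<Longrightarrow> d n + sum d H \<notin> T" by (meson Pow_iff)
  show thesis
  proof
    fix H :: "nat set" assume H: "finite H" "H \<noteq> {}"
    \<comment> \<open>The largest index of \<open>H\<close> is the stage at which this sum was kept
      out of \<open>T\<close>.\<close>
    have "H - {Max H} \<subseteq> {..<Max H}" using H by (auto simp: less_le)
    from d[OF this] show "sum d H \<notin> T"
      using H by (simp add: sum.remove[of H "Max H"])
  qed
qed

text \<open>This gives the transfinite selection its room, since members of an ultrafilter in
  \<open>JpUF S\<close> are as large as \<open>S\<close>. It also supplies the full cardinality that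
  almost disjoint families require.\<close>

lemma JpSet_eqpoll:
  fixes S :: "'a::comm_ring_1 set"
  assumes diff: "diff_set S = UNIV" and inf: "infinite S" and A: "JpSet S A"
  shows "A \<approx> S"
proof (rule ccontr)
  assume "\<not> A \<approx> S"
  moreover have AS: "A \<subseteq> S" using A by (simp add: JpSet_def)
  ultimately have "A \<prec> S" by (simp add: lesspoll_def subset_imp_lepoll)
  then have "A \<times> A \<prec> S" by (rule Times_lesspoll[OF inf])
  then have "(\<lambda>(a, b). a - b) ` (A \<times> A) \<prec> S" (is "?T \<prec> S")
    by (rule lesspoll_trans1[OF image_lepoll])
  then have T: "?T \<prec> (UNIV :: 'a set)"
    by (rule lesspoll_trans2[OF _ subset_imp_lepoll]) simp
  have "infinite (UNIV :: 'a set)" using infinite_super[OF subset_UNIV inf] .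
  \<comment> \<open>If \<open>A\<close> were small, two sequences in \<open>S\<close> whose difference has no finite sum in \<open>A - A\<close> would refute \<open>J\<^sub>p\<close>.\<close>
  then obtain d :: "nat \<Rightarrow> 'a" where d: "\<And>H. finite H \<Longrightarrow> H \<noteq> {} \<Longrightarrow> sum d H \<notin> ?T"
    using finite_sums_avoid T by blast
  have "\<forall>t. \<exists>u v. u \<in> S \<and> v \<in> S \<and> d t = u - v"
    using diff unfolding diff_set_def by blast
  then obtain u v where uv: "\<And>t. u t \<in> S" "\<And>t. v t \<in> S" "\<And>t. d t = u t - v t" by metis
  have "id \<in> (PolyFuns :: ('a \<Rightarrow> 'a) set)"
    unfolding PolyFuns_def by (rule CollectI, rule exI[of _ "[:0, 1:]"]) auto
  then have "\<exists>a\<in>S. \<exists>H. finite H \<and> H \<noteq> {} \<and> H \<subseteq> {1..} \<and> S_RL {id} {u, v} a H \<subseteq> A"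
    using A uv(1,2) unfolding JpSet_def
    by (elim conjE allE[of _ "{id}"] allE[of _ "{u, v}"]) auto
  then obtain a H where H: "finite H" "H \<noteq> {}" "S_RL {id} {u, v} a H \<subseteq> A" by blast
  have "a + sum u H \<in> A" "a + sum v H \<in> A" using H(3) by (auto simp: S_RL_def)
  moreover have "sum d H = (a + sum u H) - (a + sum v H)" by (simp add: uv(3) sum_subtractf)
  ultimately have "sum d H \<in> ?T" by (metis (mono_tags, lifting) SigmaI image_eqI case_prod_conv)
  then show False using d H(1,2) by blast
qed

section \<open>Sets and ultrafilters of type \<open>J\<^sub>p\<close>\<close>

lemma mem_uf_plusI:
  assumes "ultrafilter_on S p" "A \<subseteq> S" "D \<in> p" "\<And>x. x \<in> D \<Longrightarrow> shift S x A \<in> q"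
  shows "A \<in> uf_plus S p q"
proof -
  have "D \<subseteq> {x \<in> S. shift S x A \<in> q}"
    using assms(4) ultrafilter_onD(1)[OF assms(1,3)] by auto
  then have "{x \<in> S. shift S x A \<in> q} \<in> p"
    by (rule ultrafilter_onD(5)[OF assms(1,3)]) auto
  then show ?thesis using assms(2) by (simp add: mem_uf_plus)
qed

lemma shift_mem_uf_plusI:
  fixes S :: "'a::semigroup_add set"
  assumes "\<And>x y. x \<in> S \<Longrightarrow> y \<in> S \<Longrightarrow> x + y \<in> S"
    and "ultrafilter_on S p" "y \<in> S" "D \<in> p" "\<And>x. x \<in> D \<Longrightarrow> shift S (y + x) A \<in> q"
  shows "shift S y A \<in> uf_plus S p q"
proof (rule mem_uf_plusI[OF assms(2) shift_subset assms(4)])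
  fix x assume x: "x \<in> D"
  then have "x \<in> S" using ultrafilter_onD(1)[OF assms(2,4)] by blast
  then show "shift S x (shift S y A) \<in> q"
    using assms(5)[OF x] shift_shift[OF assms(1)] by simp
qed

lemma CpSet_subset_eqpoll:
  assumes "diff_set S = UNIV" "infinite S" "CpSet S A"
  shows "A \<subseteq> S" "A \<approx> S"
proof -
  have "JpSet S A" using assms(3) by (auto simp: CpSet_def JpUF_def)
  then show "A \<subseteq> S" "A \<approx> S"
    using JpSet_eqpoll[OF assms(1,2)] by (simp_all add: JpSet_def)
qed

lemma CpSet_superset:
  assumes "CpSet S A" "A \<subseteq> B" "B \<subseteq> S"
  shows "CpSet S B"
proof -
  obtain p where p: "p \<in> JpUF S" "uf_plus S p p = p" "A \<in> p"
    using assms(1) by (auto simp: CpSet_def)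
  then have "B \<in> p"
    using ultrafilter_onD(5)[OF _ p(3) assms(2,3)] by (simp add: JpUF_def)
  then show ?thesis using p by (auto simp: CpSet_def)
qed

text \<open>This exhibits \<open>JpUF S\<close> as a closed set, so that the idempotent lemma
  applies to closed subsemigroups inside it.\<close>

lemma JpUF_eq_uf_closure: "JpUF S = uf_closure S {S - B |B. B \<subseteq> S \<and> \<not> JpSet S B}"
proof -
  have "(\<forall>A\<in>p. JpSet S A) \<longleftrightarrow> (\<forall>B. B \<subseteq> S \<and> \<not> JpSet S B \<longrightarrow> S - B \<in> p)"
    if p: "ultrafilter_on S p" for p
    using ultrafilter_onD(1,6)[OF p] by meson
  then show ?thesis by (auto simp: JpUF_def uf_closure_def)
qed

text \<open>A configuration \<open>S_RL R L a H\<close> is finite, so if all its points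
  \<open>x\<close> satisfy \<open>shift S x A \<in> q\<close>, one \<open>y\<close> lies in all
  these shifts, and replacing \<open>a\<close> by \<open>a + y\<close> moves the configuration into
  \<open>A\<close>. As \<open>q\<close> is arbitrary, an auxiliary ultrafilter outside
  \<open>JpUF S\<close> can be absorbed later.\<close>

lemma JpUF_plus:
  assumes closed: "\<And>x y. x \<in> S \<Longrightarrow> y \<in> S \<Longrightarrow> x + y \<in> S"
    and p: "p \<in> JpUF S" and q: "ultrafilter_on S q"
  shows "uf_plus S p q \<in> JpUF S"
proof -
  have up: "ultrafilter_on S p" using p by (simp add: JpUF_def)
  have "JpSet S A" if A: "A \<in> uf_plus S p q" for A
  proof -
    let ?D = "{x \<in> S. shift S x A \<in> q}"
    have D: "JpSet S ?D" using A p by (simp add: mem_uf_plus JpUF_def)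
    have "\<exists>a\<in>S. \<exists>H. finite H \<and> H \<noteq> {} \<and> H \<subseteq> {1..} \<and> S_RL R L a H \<subseteq> A"
      if RL: "finite R \<and> R \<noteq> {} \<and> R \<subseteq> PolyFuns \<and> finite L \<and> L \<noteq> {} \<and> (\<forall>g\<in>L. \<forall>t\<ge>1. g t \<in> S)"
      for R L
    proof -
      obtain a H where aH: "a \<in> S" "finite H" "H \<noteq> {}" "H \<subseteq> {1..}" "S_RL R L a H \<subseteq> ?D"
        using D[unfolded JpSet_def, THEN conjunct2, rule_format, OF RL] by blast
      have "S_RL R L a H = (\<lambda>(f, g). a + f (sum g H)) ` (R \<times> L)"
        by (auto simp: S_RL_def)
      then have "finite (S_RL R L a H)" using RL by simp
      then have "S \<inter> \<Inter>((\<lambda>x. shift S x A) ` S_RL R L a H) \<in> q"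
        by (intro ultrafilter_on_Inter[OF q]) (use aH(5) in auto)
      then have "S \<inter> \<Inter>((\<lambda>x. shift S x A) ` S_RL R L a H) \<noteq> {}"
        using ultrafilter_onD(3)[OF q] by metis
      then obtain y where y: "y \<in> S" "\<And>x. x \<in> S_RL R L a H \<Longrightarrow> y \<in> shift S x A"
        by auto
      have "S_RL R L (a + y) H \<subseteq> A"
      proof
        fix z assume "z \<in> S_RL R L (a + y) H"
        then obtain f g where fg: "f \<in> R" "g \<in> L" "z = a + y + f (sum g H)"
          by (auto simp: S_RL_def)
        then have "y \<in> shift S (a + f (sum g H)) A" by (intro y(2)) (auto simp: S_RL_def)
        then show "z \<in> A" by (simp add: shift_def fg(3) algebra_simps)
      qed
      then show ?thesis using closed[OF aH(1) y(1)] aH by blast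
    qed
    then show ?thesis using A by (simp add: JpSet_def mem_uf_plus)
  qed
  then show ?thesis using ultrafilter_on_plus[OF closed up q] by (simp add: JpUF_def)
qed

text \<open>Idempotence says that a member \<open>D\<close> of \<open>p\<close> has
  \<open>shift S x D \<in> p\<close> for \<open>p\<close>-many \<open>x\<close>. Applied to
  \<open>A\<close> this puts the witness \<open>?B\<close> into \<open>p\<close>; applied to
  \<open>shift S x A\<close> it gives the membership of \<open>shift S x ?B\<close>.\<close>

lemma idempotent_star:
  fixes S :: "'a::semigroup_add set"
  assumes closed: "\<And>x y. x \<in> S \<Longrightarrow> y \<in> S \<Longrightarrow> x + y \<in> S"
    and p: "ultrafilter_on S p" "uf_plus S p p = p" and A: "A \<in> p"
  obtains B where "B \<in> p" "B \<subseteq> A" "\<And>x. x \<in> B \<Longrightarrow> shift S x B \<in> p"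
proof
  let ?B = "{x \<in> A. shift S x A \<in> p}"
  have star: "D \<inter> {x \<in> S. shift S x D \<in> p} \<in> p" if "D \<in> p" for D
    using ultrafilter_onD(4)[OF p(1) that] that p(2) mem_uf_plus by metis
  have AS: "A \<subseteq> S" using ultrafilter_onD(1)[OF p(1) A] .
  then have "A \<inter> {x \<in> S. shift S x A \<in> p} = ?B" by auto
  then show "?B \<in> p" using star[OF A] by simp
  show "?B \<subseteq> A" by auto
  fix x assume x: "x \<in> ?B"
  then have "x \<in> S" using AS by blast
  then have "{y \<in> S. shift S y (shift S x A) \<in> p} = {y \<in> S. shift S (x + y) A \<in> p}"
    using shift_shift[OF closed] by auto
  moreover have "shift S x A \<inter> {y \<in> S. shift S (x + y) A \<in> p} = shift S x ?B"
    by (auto simp: shift_def[of S x])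
  ultimately have "shift S x A \<inter> {y \<in> S. shift S y (shift S x A) \<in> p} = shift S x ?B"
    by simp
  then show "shift S x ?B \<in> p" using star[of "shift S x A"] x by simp
qed

text \<open>One construction serves both claims: the finite sets \<open>T b\<close> turn a bound on
  the size of \<open>B \<inter> C\<close> into one for \<open>X B \<inter> X C\<close>, and turn
  disjoint \<open>B\<close>, \<open>C\<close> into disjoint \<open>X B\<close>,
  \<open>X C\<close>.\<close>

lemma CpSet_refinements:
  fixes S :: "'a::comm_ring_1 set"
  assumes closed: "\<And>x y. x \<in> S \<Longrightarrow> y \<in> S \<Longrightarrow> x + y \<in> S"
    and diff: "diff_set S = UNIV" and inf: "infinite S" and CpA: "CpSet S A"
  obtains X where "\<And>B. B \<subseteq> S \<Longrightarrow> B \<approx> S \<Longrightarrow> X B \<subseteq> A \<and> CpSet S (X B)"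
    and "\<And>B C. B \<subseteq> S \<Longrightarrow> B \<approx> S \<Longrightarrow> C \<subseteq> S \<Longrightarrow> C \<approx> S \<Longrightarrow>
      \<exists>T. (\<forall>b. finite (T b)) \<and> X B \<inter> X C \<subseteq> (\<Union>b\<in>B \<inter> C. T b)"
proof -
  obtain p where p: "p \<in> JpUF S" "uf_plus S p p = p" "A \<in> p"
    using CpA by (auto simp: CpSet_def)
  then have up: "ultrafilter_on S p" by (simp add: JpUF_def)
  obtain A' where A': "A' \<in> p" "A' \<subseteq> A" and star: "\<And>x. x \<in> A' \<Longrightarrow> shift S x A' \<in> p"
    using idempotent_star[OF closed up p(2,3)] by blast
  have A'S: "A' \<subseteq> S" using ultrafilter_onD(1)[OF up A'(1)] .
  \<comment> \<open>\<open>M E\<close> consists of the points that translate all of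
    \<open>A' \<inter> E\<close> into \<open>A'\<close>. For finite \<open>E\<close> it lies in
    \<open>p\<close>, hence has full cardinality.\<close>
  define M where "M E = S \<inter> \<Inter>((\<lambda>x. shift S x A') ` (A' \<inter> E))" for E
  have "S \<lesssim> M (snd j)" if "j \<in> S \<times> Fpow S" for j
  proof -
    have "finite (snd j)" using that by (auto simp: Fpow_def)
    then have "M (snd j) \<in> p"
      unfolding M_def using star by (intro ultrafilter_on_Inter[OF up]) auto
    then have "JpSet S (M (snd j))" using p(1) by (simp add: JpUF_def)
    then show ?thesis using JpSet_eqpoll[OF diff inf] eqpoll_sym eqpoll_imp_lepoll by blast
  qed
  moreover have "S \<times> Fpow S \<lesssim> S"
  proof -
    have "S \<times> Fpow S \<approx> S \<times> S"
      using eqpoll_Fpow[OF inf] by (intro times_eqpoll_cong) auto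
    also have "\<dots> \<approx> S"
      using inf by (simp add: eqpoll_iff_card_of_ordIso card_of_Times_same_infinite)
    finally show ?thesis by (rule eqpoll_imp_lepoll)
  qed
  moreover have "finite (snd j)" if "j \<in> S \<times> Fpow S" for j
    using that by (auto simp: Fpow_def)
  ultimately obtain y where yM: "\<And>j. j \<in> S \<times> Fpow S \<Longrightarrow> y j \<in> M (snd j)"
    and yinj: "\<And>i j x x'. \<lbrakk>i \<in> S \<times> Fpow S; j \<in> S \<times> Fpow S; x \<in> snd i; x' \<in> snd j;
      x + y i = x' + y j\<rbrakk> \<Longrightarrow> i = j"
    using disjoint_translates_selection[OF inf, of "S \<times> Fpow S" "\<lambda>j. M (snd j)" snd] by metis
  have "\<exists>f. inj_on f (Fpow S) \<and> f ` Fpow S \<subseteq> B" if "B \<approx> S" for B :: "'a set"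
  proof -
    have "Fpow S \<approx> B" using eqpoll_Fpow[OF inf] that by (metis eqpoll_sym eqpoll_trans)
    then have "Fpow S \<lesssim> B" by (rule eqpoll_imp_lepoll)
    then show ?thesis by (simp add: lepoll_def)
  qed
  then obtain c :: "'a set \<Rightarrow> 'a set \<Rightarrow> 'a" where c: "\<And>B. B \<approx> S \<Longrightarrow> inj_on (c B) (Fpow S)"
    "\<And>B. B \<approx> S \<Longrightarrow> c B ` Fpow S \<subseteq> B" by metis
  define Z where "Z B = {x + y (c B E, E) | x E. E \<in> Fpow S \<and> x \<in> E}" for B
  show thesis
  proof
    fix B assume B: "B \<subseteq> S" "B \<approx> S"
    have cS: "(c B E, E) \<in> S \<times> Fpow S" if "E \<in> Fpow S" for E
      using that c(2)[OF B(2)] B(1) by auto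
    have yS: "y (c B E, E) \<in> S" if "E \<in> Fpow S" for E
      using yM[OF cS[OF that]] by (simp add: M_def)
    define V where "V E0 = {y (c B E, E) | E. E \<in> Fpow S \<and> E0 \<subseteq> E}" for E0
    have VS: "V E0 \<subseteq> S" for E0 using yS by (auto simp: V_def)
    have ZS: "Z B \<subseteq> S" using yS closed by (auto simp: Z_def Fpow_def)
    have shiftZ: "V {x} \<subseteq> shift S x (Z B)" for x
      using yS by (auto simp: V_def Z_def shift_def)
    have shiftA': "V {x} \<subseteq> shift S x A'" if "x \<in> A'" for x
    proof
      fix z assume "z \<in> V {x}"
      then obtain E where "E \<in> Fpow S" "x \<in> E" "z = y (c B E, E)" by (auto simp: V_def)
      then show "z \<in> shift S x A'" using yM[OF cS, of E] that by (auto simp: M_def)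
    qed
    have "S \<inter> \<Inter>F \<noteq> {}" if F: "finite F" "F \<subseteq> V ` Fpow S" for F
    proof -
      obtain G where G: "G \<subseteq> Fpow S" "finite G" "F = V ` G"
        using finite_subset_image[OF F] by blast
      \<comment> \<open>The finite subsets of \<open>S\<close> are directed: the point indexed by
        the union of \<open>G\<close> lies in every \<open>V E\<close> with \<open>E\<close> in
        \<open>G\<close>.\<close>
      then have "\<Union>G \<in> Fpow S" by (auto simp: Fpow_def)
      then have "y (c B (\<Union>G), \<Union>G) \<in> S \<inter> \<Inter>F"
        using yS[of "\<Union>G"] unfolding G(3) V_def by blast
      then show ?thesis by blast
    qed
    moreover have "V ` Fpow S \<subseteq> Pow S" using VS by blast
    ultimately obtain q where "q \<in> uf_closure S (V ` Fpow S)"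
      using uf_closure_nonempty_iff[of "V ` Fpow S" S] by blast
    then have q: "ultrafilter_on S q" and Vq: "\<And>E. E \<in> Fpow S \<Longrightarrow> V E \<in> q"
      by (auto simp: uf_closure_def)
    have V1q: "V {x} \<in> q" if "x \<in> S" for x using that by (intro Vq) (simp add: Fpow_def)
    have qZ: "shift S x (Z B) \<in> q" if "x \<in> S" for x
      by (rule ultrafilter_onD(5)[OF q V1q[OF that] shiftZ shift_subset])
    have qA': "shift S x A' \<in> q" if "x \<in> A'" for x
      using ultrafilter_onD(5)[OF q V1q shiftA'[OF that] shift_subset] that A'S by blast
    \<comment> \<open>The first family encodes membership in \<open>JpUF S\<close>; the others list
      the invariants that make the closed set a semigroup.\<close>
    define K where "K = {S - D |D. D \<subseteq> S \<and> \<not> JpSet S D} \<union> {A', Z B} \<union>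
      (\<lambda>x. shift S x A') ` A' \<union> (\<lambda>x. shift S x (Z B)) ` S"
    have K_iff: "r \<in> uf_closure S K \<longleftrightarrow> r \<in> JpUF S \<and> A' \<in> r \<and> Z B \<in> r \<and>
      (\<forall>x\<in>A'. shift S x A' \<in> r) \<and> (\<forall>x\<in>S. shift S x (Z B) \<in> r)" for r
      unfolding JpUF_eq_uf_closure by (simp add: K_def uf_closure_def image_subset_iff) blast
    have KS: "K \<subseteq> Pow S"
    proof -
      have "{A', Z B} \<subseteq> Pow S" using A'S ZS by simp
      moreover have "(\<lambda>x. shift S x D) ` D' \<subseteq> Pow S" for D D' using shift_subset by blast
      moreover have "{S - D |D. D \<subseteq> S \<and> \<not> JpSet S D} \<subseteq> Pow S" by auto
      ultimately show ?thesis by (simp add: K_def)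
    qed
    \<comment> \<open>The hypotheses on \<open>r\<close> and \<open>s\<close> are kept asymmetric so
      as to cover \<open>p + q\<close> too: \<open>p\<close> is not known to contain
      \<open>Z B\<close>, nor \<open>q\<close> to lie in \<open>JpUF S\<close>.\<close>
    have mem_K: "uf_plus S r s \<in> uf_closure S K"
      if r: "r \<in> JpUF S" "A' \<in> r" "\<And>x. x \<in> A' \<Longrightarrow> shift S x A' \<in> r"
        and s: "ultrafilter_on S s" "\<And>x. x \<in> A' \<Longrightarrow> shift S x A' \<in> s"
          "\<And>x. x \<in> S \<Longrightarrow> shift S x (Z B) \<in> s" for r s
    proof -
      have ur: "ultrafilter_on S r" using r(1) by (simp add: JpUF_def)
      note Sr = ultrafilter_onD(2)[OF ur]
      have "A' \<in> uf_plus S r s" by (rule mem_uf_plusI[OF ur A'S r(2) s(2)])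
      moreover have "Z B \<in> uf_plus S r s" by (rule mem_uf_plusI[OF ur ZS Sr s(3)])
      moreover have "shift S x A' \<in> uf_plus S r s" if x: "x \<in> A'" for x
      proof (rule shift_mem_uf_plusI[OF closed ur _ r(3)[OF x]])
        show "x \<in> S" using x A'S by blast
        show "shift S (x + z) A' \<in> s" if "z \<in> shift S x A'" for z
          using that by (intro s(2)) (simp add: shift_def)
      qed
      moreover have "shift S x (Z B) \<in> uf_plus S r s" if "x \<in> S" for x
        using that by (intro shift_mem_uf_plusI[OF closed ur that Sr] s(3) closed)
      ultimately show ?thesis
        using JpUF_plus[OF closed r(1) s(1)] by (simp add: K_iff)
    qed
    have "uf_plus S p q \<in> uf_closure S K"
      using mem_K[OF p(1) A'(1) star q qA' qZ] .
    then have "uf_closure S K \<noteq> {}" by blast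
    moreover have "uf_plus S r s \<in> uf_closure S K"
      if "r \<in> uf_closure S K" "s \<in> uf_closure S K" for r s
      using that unfolding K_iff[of r] K_iff[of s] by (intro mem_K) (auto simp: JpUF_def)
    ultimately obtain r where r: "r \<in> uf_closure S K" "uf_plus S r r = r"
      using idempotent_in_closed_semigroup[OF closed KS] by blast
    then have ur: "r \<in> JpUF S" "A' \<in> r" "Z B \<in> r" by (simp_all add: K_iff)
    then have "A' \<inter> Z B \<in> r" using ultrafilter_onD(4)[of S r] by (simp add: JpUF_def)
    then have "CpSet S (A' \<inter> Z B)" using r(2) ur(1) by (auto simp: CpSet_def)
    then show "A' \<inter> Z B \<subseteq> A \<and> CpSet S (A' \<inter> Z B)" using A'(2) by blast
  next
    fix B C assume BC: "B \<subseteq> S" "B \<approx> S" "C \<subseteq> S" "C \<approx> S"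
    \<comment> \<open>Since \<open>c B\<close> is injective, \<open>b\<close> tags at most one
      finite set \<open>E\<close>, so \<open>T b\<close> is finite.\<close>
    define T where "T b = {x + y (b, E) | x E. E \<in> Fpow S \<and> x \<in> E \<and> c B E = b}" for b
    have "finite (T b)" for b
    proof (cases "b \<in> c B ` Fpow S")
      case True
      then obtain E where E: "E \<in> Fpow S" "c B E = b" by blast
      then have "T b \<subseteq> (\<lambda>x. x + y (b, E)) ` E"
        using inj_onD[OF c(1)[OF BC(2)]] by (auto simp: T_def)
      then show ?thesis using E(1) finite_subset by (auto simp: Fpow_def)
    next
      case False
      then have "T b = {}" by (auto simp: T_def)
      then show ?thesis by simp
    qed
    moreover have "Z B \<inter> Z C \<subseteq> (\<Union>b\<in>B \<inter> C. T b)"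
    proof
      fix z assume z: "z \<in> Z B \<inter> Z C"
      then obtain x E where 1: "z = x + y (c B E, E)" "E \<in> Fpow S" "x \<in> E"
        unfolding Z_def by blast
      obtain x' E' where 2: "z = x' + y (c C E', E')" "E' \<in> Fpow S" "x' \<in> E'"
        using z unfolding Z_def by blast
      have mem: "c B E \<in> B" "c C E' \<in> C" using 1(2) 2(2) c(2) BC(2,4) by blast+
      \<comment> \<open>The translates are disjoint for different indices, so a common point has the
        same tag in both representations, and this tag lies in \<open>B \<inter> C\<close>.\<close>
      then have "(c B E, E) = (c C E', E')"
        using BC 1 2 by (intro yinj[of _ _ x x']) auto
      then have "c B E \<in> B \<inter> C" using mem by auto
      moreover have "z \<in> T (c B E)" using 1 by (auto simp: T_def)
      ultimately show "z \<in> (\<Union>b\<in>B \<inter> C. T b)" by blast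
    qed
    ultimately show "\<exists>T. (\<forall>b. finite (T b)) \<and> (A' \<inter> Z B) \<inter> (A' \<inter> Z C) \<subseteq> (\<Union>b\<in>B \<inter> C. T b)"
      by blast
  qed
qed

section \<open>Almost disjoint families and partitions of C_p-sets\<close>

theorem theorem5p2:
  fixes S :: "'a::idom set" and D :: "'d set"
  assumes "\<forall>x\<in>S. \<forall>y\<in>S. x + y \<in> S"
    and "\<not> (\<exists>e\<in>S. \<forall>s\<in>S. e + s = s)"
    and "diff_set S = UNIV"
    and "infinite S"
  shows "((\<exists>F. ad_family S F \<and> F \<approx> D) \<longrightarrow>
           (\<forall>A. CpSet S A \<longrightarrow>
              (\<exists>G. G \<subseteq> Pow A \<and> ad_family A G \<and> G \<approx> D \<and> (\<forall>B\<in>G. CpSet S B))))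
       \<and> (\<forall>A. CpSet S A \<longrightarrow>
              (\<exists>B :: 'a \<Rightarrow> 'a set. (\<Union>x\<in>S. B x) = A \<and>
                 (\<forall>x\<in>S. CpSet S (B x)) \<and>
                 (\<forall>x\<in>S. \<forall>y\<in>S. x \<noteq> y \<longrightarrow> B x \<inter> B y = {})))"
proof (intro conjI impI allI)
  have closed: "x + y \<in> S" if "x \<in> S" "y \<in> S" for x y using assms(1) that by blast
  note Cp = CpSet_subset_eqpoll[OF assms(3,4)]
  fix A assume A: "CpSet S A"
  obtain X where X: "\<And>B. B \<subseteq> S \<Longrightarrow> B \<approx> S \<Longrightarrow> X B \<subseteq> A \<and> CpSet S (X B)"
    and XX: "\<And>B C. B \<subseteq> S \<Longrightarrow> B \<approx> S \<Longrightarrow> C \<subseteq> S \<Longrightarrow> C \<approx> S \<Longrightarrow>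
      \<exists>T. (\<forall>b. finite (T b)) \<and> X B \<inter> X C \<subseteq> (\<Union>b\<in>B \<inter> C. T b)"
    using CpSet_refinements[OF closed assms(3,4) A] by blast
  {
    assume "\<exists>F. ad_family S F \<and> F \<approx> D"
    then obtain F where F: "ad_family S F" "F \<approx> D" by blast
    have FS: "B \<subseteq> S" "B \<approx> S" if "B \<in> F" for B using F(1) that by (auto simp: ad_family_def)
    have small: "X B \<inter> X C \<prec> S" if BC: "B \<in> F" "C \<in> F" "B \<noteq> C" for B C
    proof -
      obtain T where T: "\<And>b. finite (T b)" "X B \<inter> X C \<subseteq> (\<Union>b\<in>B \<inter> C. T b)"
        using XX[OF FS[OF BC(1)] FS[OF BC(2)]] by blast
      have "B \<inter> C \<prec> S" using F(1) BC unfolding ad_family_def by blast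
      then have "(\<Union>b\<in>B \<inter> C. T b) \<prec> S" using T(1) by (intro UN_finite_lesspoll[OF assms(4)])
      then show ?thesis using lesspoll_trans1[OF subset_imp_lepoll[OF T(2)]] by blast
    qed
    have big: "X B \<approx> S" if "B \<in> F" for B using Cp(2) X[OF FS[OF that]] by blast
    have AS: "S \<approx> A" using Cp(2)[OF A] by (rule eqpoll_sym)
    \<comment> \<open>If two members had the same image, that image would be both of size
      \<open>|S|\<close> and smaller than \<open>S\<close>. Hence \<open>X\<close> preserves the
      size of the family.\<close>
    have "inj_on X F"
    proof (rule inj_onI, rule ccontr)
      fix B C assume BC: "B \<in> F" "C \<in> F" "X B = X C" "B \<noteq> C"
      then have "X B \<prec> S" using small[OF BC(1,2,4)] by simp
      then show False using big[OF BC(1)] by (simp add: lesspoll_def)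
    qed
    then have "X ` F \<approx> D" using F(2) by (metis eqpoll_trans inj_on_image_eqpoll_self)
    moreover have "X ` F \<subseteq> Pow A" "\<forall>B\<in>X ` F. CpSet S B" using X FS by auto
    moreover have "ad_family A (X ` F)"
      unfolding ad_family_def
    proof (intro conjI ballI impI)
      show "B \<subseteq> A" if "B \<in> X ` F" for B using that X FS by blast
      show "B \<approx> A" if "B \<in> X ` F" for B using that big AS eqpoll_trans by blast
      show "B \<inter> C \<prec> A" if "B \<in> X ` F" "C \<in> X ` F" "B \<noteq> C" for B C
      proof -
        have "B \<inter> C \<prec> S" using that small by auto
        then show ?thesis using lesspoll_trans2 eqpoll_imp_lepoll[OF AS] by blast
      qed
    qed
    ultimately show "\<exists>G. G \<subseteq> Pow A \<and> ad_family A G \<and> G \<approx> D \<and> (\<forall>B\<in>G. CpSet S B)" by blast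
  }
  have "S \<times> S \<approx> S"
    using assms(4) by (simp add: eqpoll_iff_card_of_ordIso card_of_Times_same_infinite)
  then obtain f where f: "bij_betw f (S \<times> S) S" by (auto simp: eqpoll_def)
  \<comment> \<open>The rows of \<open>S \<times> S\<close> are carried over to \<open>S\<close>:
    they form \<open>|S|\<close> disjoint sets, each of size \<open>|S|\<close>.\<close>
  define P where "P x = f ` ({x} \<times> S)" for x
  have P: "P x \<subseteq> S" "P x \<approx> S" if x: "x \<in> S" for x
  proof -
    show "P x \<subseteq> S" using f x by (auto simp: P_def bij_betw_def)
    have "inj_on (\<lambda>z. f (x, z)) S"
      using f x by (auto simp: bij_betw_def inj_on_def)
    moreover have "P x = (\<lambda>z. f (x, z)) ` S" by (auto simp: P_def)
    ultimately show "P x \<approx> S" by (simp add: inj_on_image_eqpoll_self)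
  qed
  have disj: "X (P x) \<inter> X (P z) = {}" if "x \<in> S" "z \<in> S" "x \<noteq> z" for x z
  proof -
    have "P x \<inter> P z = {}"
      using f that by (auto simp: P_def bij_betw_def inj_on_def)
    then show ?thesis using XX[OF P[OF that(1)] P[OF that(2)]] by auto
  qed
  obtain x0 where x0: "x0 \<in> S" using assms(4) by fastforce
  \<comment> \<open>The cell at \<open>x0\<close> takes up the remainder of \<open>A\<close>, so the
    cells cover \<open>A\<close>. It is still a C_p-set because it contains
    \<open>X (P x0)\<close>.\<close>
  define B where "B x = (if x = x0 then A - (\<Union>z\<in>S - {x0}. X (P z)) else X (P x))" for x
  have XA: "X (P x) \<subseteq> A" "CpSet S (X (P x))" if "x \<in> S" for x
    using X[OF P[OF that]] by simp_all
  show "\<exists>B. (\<Union>x\<in>S. B x) = A \<and> (\<forall>x\<in>S. CpSet S (B x)) \<and>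
      (\<forall>x\<in>S. \<forall>y\<in>S. x \<noteq> y \<longrightarrow> B x \<inter> B y = {})"
  proof (intro exI[of _ B] conjI ballI impI)
    show "(\<Union>x\<in>S. B x) = A"
    proof
      show "(\<Union>x\<in>S. B x) \<subseteq> A" using XA(1) by (auto simp: B_def)
      show "A \<subseteq> (\<Union>x\<in>S. B x)"
      proof
        fix z assume z: "z \<in> A"
        show "z \<in> (\<Union>x\<in>S. B x)"
        proof (cases "\<exists>x\<in>S - {x0}. z \<in> X (P x)")
          case True
          then show ?thesis by (auto simp: B_def)
        next
          case False
          then have "z \<in> B x0" using z by (simp add: B_def)
          then show ?thesis using x0 by blast
        qed
      qed
    qed
    show "CpSet S (B x)" if "x \<in> S" for x
    proof (cases "x = x0")
      case True
      have "X (P x0) \<subseteq> B x0" using XA(1)[OF x0] disj[OF x0] by (auto simp: B_def)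
      moreover have "B x0 \<subseteq> S" using Cp(1)[OF A] by (auto simp: B_def)
      ultimately show ?thesis using CpSet_superset[OF XA(2)[OF x0]] True by blast
    next
      case False
      then show ?thesis using XA(2)[OF that] by (simp add: B_def)
    qed
    show "B x \<inter> B y = {}" if "x \<in> S" "y \<in> S" "x \<noteq> y" for x y
      using that disj[OF that] by (auto simp: B_def)
  qed
qed

end
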